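(* Let $\{\widetilde{C}_k(x,t)\}$ be the Poisson-Charlier polynomials, defined by $\sum_{k\ge0}\widetilde{C}_k(x,t)\frac{z^k}{k!}=e^{-tz}(1+z)^x$, and for nonnegative integers $j$ and $t\ge0$ let $Q_j(x,t)=E[\{x-t\mathbf{.}\beta\mathbf{.}(u\,\dot{-}\,\chi)\}^j]$, where $u\,\dot{-}\,\chi$ is the umbra with generating function $e^z-z$. Then for all integers $k\ge1$ $$\widetilde{C}_k(x+t,t)=\sum_{j=1}^k s(k,j)\,Q_j(x,t),$$ where $s(k,j)$ are the (signed) Stirling numbers of the first kind.
   Context: An umbra $\gamma$ is a symbol representing a sequence $g_0=1,g_1,g_2,\ldots$ of real numbers through a linear evaluation functional $E$ with $E[\gamma^n]=g_n$ (the $n$-th moment); $E$ is linear over $\mathbb{R}[x]$ and $E[1]=1$. The generating function of $\gamma$ is the formal power series $f(\gamma,z)=\sum_{n\ge0}g_nz^n/n!$. The unity umbra $u$ has all moments equal to $1$ ($f(u,z)=e^z$); the singleton umbra $\chi$ has $f(\chi,z)=1+z$. The disjoint difference $\delta_1\,\dot{-}\,\delta_2$ of two umbrae has generating function $f(\delta_1,z)-f(\delta_2,z)+1$; thus $f(u\,\dot{-}\,\chi,z)=e^z-z$. For $t\in\mathbb{R}$, $t\mathbf{.}\beta\mathbf{.}\gamma$ ($\beta$ the Bell umbra, whose moments are the Bell numbers) is the auxiliary umbra with generating function $\exp[t(f(\gamma,z)-1)]$, i.e. $E[(t\mathbf{.}\beta\mathbf{.}\gamma)^i]=\sum_{m=1}^i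 t^mB_{i,m}(g_1,\ldots,g_{i-m+1})$ for $i\ge1$, with $B_{i,m}$ the partial exponential Bell polynomials. $x-t\mathbf{.}\beta\mathbf{.}\gamma$ means $x+(-t)\mathbf{.}\beta\mathbf{.}\gamma$; its powers are expanded by the binomial theorem and evaluated linearly with $E$. (The umbra $t\mathbf{.}\beta\mathbf{.}(u\,\dot{-}\,\chi)$ is the umbral counterpart of the compensated Poisson process of intensity $1$.) Signed Stirling numbers: $y(y-1)\cdots(y-k+1)=\sum_{j=0}^k s(k,j)y^j$. *)

theory Defs
  imports "HOL-Computational_Algebra.Formal_Power_Series" "HOL-Computational_Algebra.Polynomial"
begin

text \<open>An umbra is identified with the sequence of moments it represents.\<close>

typedef umbra = "{g :: nat \<Rightarrow> real. g 0 = 1}"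
  morphisms moment Abs_umbra
  by (rule exI[of _ "\<lambda>_. 1"]) simp

setup_lifting type_definition_umbra

definition umbra_gf :: "umbra \<Rightarrow> real fps" where
  "umbra_gf \<gamma> = Abs_fps (\<lambda>n. moment \<gamma> n / fact n)"

text \<open>
  Elements of \<open>\<real>[x][\<gamma>]\<close> are of type \<^typ>\<open>real poly poly\<close>: the outer indeterminate is the umbra,
  the inner one is \<open>x\<close>. The evaluation is the \<open>\<real>[x]\<close>-linear map sending the \<open>n\<close>-th power of the
  umbra to its \<open>n\<close>-th moment.
\<close>

definition umbral_eval :: "umbra \<Rightarrow> real poly poly \<Rightarrow> real poly" where
  "umbral_eval \<gamma> p = (\<Sum>n\<le>degree p. smult (moment \<gamma> n) (coeff p n))"

lift_definition unity_umbra :: umbra is "\<lambda>n. 1"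
  by simp

lift_definition singleton_umbra :: umbra is "\<lambda>n. if n \<le> 1 then 1 else 0"
  by simp

lift_definition disjoint_diff :: "umbra \<Rightarrow> umbra \<Rightarrow> umbra" is
  "\<lambda>g h n. fact n * fps_nth (Abs_fps (\<lambda>i. g i / fact i) - Abs_fps (\<lambda>i. h i / fact i) + 1) n"
  by simp

text \<open>The umbra \<open>t.\<beta>.\<gamma>\<close>, with generating function \<open>exp(t(f(\<gamma>,z) - 1))\<close>.\<close>

lift_definition dot_bell :: "real \<Rightarrow> umbra \<Rightarrow> umbra" is
  "\<lambda>t g n. fact n * fps_nth (fps_exp t oo (Abs_fps (\<lambda>i. g i / fact i) - 1)) n"
  by simp

lemma moment_0 [simp]: "moment \<gamma> 0 = 1"
  using moment[of \<gamma>] by simp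

lemma umbra_gf_unity: "umbra_gf unity_umbra = fps_exp 1"
  by (simp add: umbra_gf_def unity_umbra.rep_eq fps_eq_iff)

lemma umbra_gf_singleton: "umbra_gf singleton_umbra = 1 + fps_X"
  by (auto simp: umbra_gf_def singleton_umbra.rep_eq fps_eq_iff fps_X_def le_Suc_eq)

lemma umbra_gf_disjoint_diff: "umbra_gf (disjoint_diff \<gamma> \<delta>) = umbra_gf \<gamma> - umbra_gf \<delta> + 1"
  by (simp add: umbra_gf_def disjoint_diff.rep_eq fps_eq_iff)

lemma umbra_gf_dot_bell: "umbra_gf (dot_bell t \<gamma>) = fps_exp t oo (umbra_gf \<gamma> - 1)"
  by (simp add: umbra_gf_def dot_bell.rep_eq fps_eq_iff)

lemma umbra_gf_unity_diff_singleton: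
  "umbra_gf (disjoint_diff unity_umbra singleton_umbra) = fps_exp 1 - fps_X"
  by (simp add: umbra_gf_disjoint_diff umbra_gf_unity umbra_gf_singleton)

text \<open>
  Here \<open>x - t.\<beta>.\<gamma>\<close> stands for \<open>x + (-t).\<beta>.\<gamma>\<close>, which is the polynomial \<open>[:[:0, 1:], 1:]\<close> in the
  umbra \<open>(-t).\<beta>.\<gamma>\<close>. Note that \<open>(-t).\<beta>.\<gamma>\<close> is not \<open>-(t.\<beta>.\<gamma>)\<close>.
\<close>

definition Q :: "nat \<Rightarrow> real \<Rightarrow> real \<Rightarrow> real" where
  "Q j x t =
     poly (umbral_eval (dot_bell (- t) (disjoint_diff unity_umbra singleton_umbra))
            ([:[:0, 1:], 1:] ^ j)) x"

definition poisson_charlier :: "nat \<Rightarrow> real \<Rightarrow> real \<Rightarrow> real" where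
  "poisson_charlier k x t = fact k * fps_nth (fps_exp (- t) * fps_binomial x) k"

text \<open>
  The signed numbers, that is the coefficients of \<open>y(y - 1)\<dots>(y - k + 1)\<close>; the library's
  \<open>stirling\<close> is unsigned.
\<close>

definition signed_stirling :: "nat \<Rightarrow> nat \<Rightarrow> int" where
  "signed_stirling k j = coeff (\<Prod>i<k. [:- int i, 1:]) j"

end

theory Submission imports Defs begin

unbundle fps_syntax

text \<open>
  The exponential generating function of the \<open>Q\<^sub>j(x, t)\<close> is
  \<open>exp(x w) exp(- t (exp w - w - 1)) = exp((x + t) w) exp(- t (exp w - 1))\<close>. Substituting
  \<open>w = log(1 + z)\<close> turns it into \<open>(1 + z)\<^bsup>x + t\<^esup> exp(- t z)\<close>, the generating function of the
  Poisson-Charlier polynomials at \<open>x + t\<close>; on coefficients this substitution is the Stirling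
  transform, because \<open>log(1 + z)\<^sup>j / j!\<close> generates the \<open>s(k, j) / k!\<close>.
\<close>

lemma poly_umbral_eval_shifted_power:
  "poly (umbral_eval \<gamma> ([:[:0, 1:], 1:] ^ j)) x =
     (\<Sum>n\<le>j. of_nat (j choose n) * x ^ (j - n) * moment \<gamma> n)"
proof -
  have "degree ([:[:0, 1:], 1:] ^ j :: real poly poly) = j"
    by (simp add: degree_linear_power)
  then show ?thesis
    by (auto simp: umbral_eval_def poly_sum coeff_linear_poly_power poly_monom mult_ac
             simp flip: of_nat_poly intro!: sum.cong)
qed

text \<open>Divided by \<open>fact j\<close>, the binomial expansion becomes a Cauchy product:
  adding a scalar to an umbra multiplies its generating function by an exponential.\<close>

lemma egf_umbral_eval_shifted_power:
  "Abs_fps (\<lambda>j. poly (umbral_eval \<gamma> ([:[:0, 1:], 1:] ^ j)) x / fact j) = fps_exp x * umbra_gf \<gamma>"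
proof (rule fps_ext)
  fix j
  have "of_nat (j choose n) * x ^ (j - n) * moment \<gamma> n / fact j =
      x ^ (j - n) / fact (j - n) * (moment \<gamma> n / fact n)" if "n \<le> j" for n
    using that by (simp add: binomial_fact field_simps)
  then have "(\<Sum>n\<le>j. of_nat (j choose n) * x ^ (j - n) * moment \<gamma> n) / fact j =
      (\<Sum>n=0..j. x ^ (j - n) / fact (j - n) * (moment \<gamma> n / fact n))"
    by (simp add: sum_divide_distrib atMost_atLeast0)
  also have "\<dots> = (umbra_gf \<gamma> * fps_exp x) $ j"
    unfolding fps_mult_nth by (simp add: umbra_gf_def mult_ac)
  finally show "Abs_fps (\<lambda>j. poly (umbral_eval \<gamma> ([:[:0, 1:], 1:] ^ j)) x / fact j) $ j =
      (fps_exp x * umbra_gf \<gamma>) $ j"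
    by (simp add: poly_umbral_eval_shifted_power mult.commute)
qed

text \<open>Multiplying the left side by the inverses of both right-hand factors gives
  \<open>?f\<close>. In its derivative the three product-rule terms cancel, and its constant term is
  1.\<close>

lemma fps_exp_compose_add:
  fixes c :: "'a::field_char_0"
  assumes "a $ 0 = 0" "b $ 0 = 0"
  shows "fps_exp c oo (a + b) = (fps_exp c oo a) * (fps_exp c oo b)"
proof -
  let ?f = "(fps_exp c oo (a + b)) * (fps_exp (- c) oo a) * (fps_exp (- c) oo b)"
  have inv: "(fps_exp (- c) oo d) * (fps_exp c oo d) = 1" if "d $ 0 = 0" for d
    using fps_compose_mult_distrib[OF that, of "fps_exp (- c)" "fps_exp c"]
    by (simp flip: fps_exp_add_mult)
  have "fps_deriv ?f = 0"
    using assms by (simp add: fps_compose_deriv fps_compose_uminus algebra_simps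
             flip: fps_const_mult_apply_left fps_const_neg)
  then have "?f = 1"
    using fps_deriv_eq_0_iff[of ?f] by simp
  then have "?f * ((fps_exp c oo a) * (fps_exp c oo b)) = (fps_exp c oo a) * (fps_exp c oo b)"
    by simp
  moreover have "?f * ((fps_exp c oo a) * (fps_exp c oo b)) = (fps_exp c oo (a + b)) *
      ((fps_exp (- c) oo a) * (fps_exp c oo a)) * ((fps_exp (- c) oo b) * (fps_exp c oo b))"
    by (simp add: mult_ac)
  ultimately show ?thesis
    using inv assms by simp
qed

lemma egf_Q:
  "Abs_fps (\<lambda>j. Q j x t / fact j) = fps_exp (x + t) * (fps_exp (- t) oo (fps_exp 1 - 1))"
proof -
  \<comment> \<open>Splitting off \<open>- fps_X\<close> yields the factor \<open>fps_exp t\<close>,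
    which shifts \<open>x\<close> to \<open>x + t\<close>.\<close>
  have "fps_exp (- t) oo (fps_exp 1 - fps_X - 1) =
      fps_exp (- t) oo ((fps_exp 1 - 1) + (- fps_X))"
    by (simp add: algebra_simps)
  also have "\<dots> = (fps_exp (- t) oo (fps_exp 1 - 1)) * fps_exp t"
    by (subst fps_exp_compose_add) simp_all
  finally show ?thesis
    unfolding Q_def egf_umbral_eval_shifted_power umbra_gf_dot_bell umbra_gf_unity_diff_singleton
    by (simp add: fps_exp_add_mult mult_ac)
qed

text \<open>Both series solve (1 + z) f' = c f with constant term 1, which determines f.\<close>

lemma fps_exp_compose_fps_ln_1: "fps_exp c oo fps_ln 1 = fps_binomial (c :: 'a::field_char_0)"
proof -
  have "fps_deriv (fps_exp c oo fps_ln 1) = fps_const c * (fps_exp c oo fps_ln 1) / (1 + fps_X)"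
    by (simp add: fps_compose_deriv fps_ln_deriv fps_divide_unit flip: fps_const_mult_apply_left)
  then show ?thesis
    using fps_binomial_ODE_unique'[of "fps_exp c oo fps_ln 1" c] by simp
qed

lemma signed_stirling_0: "signed_stirling 0 j = (if j = 0 then 1 else 0)"
  by (simp add: signed_stirling_def)

lemma signed_stirling_Suc_0: "signed_stirling (Suc k) 0 = - int k * signed_stirling k 0"
  by (simp add: signed_stirling_def mult.commute)

lemma signed_stirling_Suc_Suc:
  "signed_stirling (Suc k) (Suc j) = signed_stirling k j - int k * signed_stirling k (Suc j)"
  by (simp add: signed_stirling_def mult.commute[of _ "[:_, _:]"])

lemma signed_stirling_eq_0: "k < j \<Longrightarrow> signed_stirling k j = 0"
proof (induction k arbitrary: j)
  case (Suc k)
  then show ?case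
    by (cases j) (simp_all add: signed_stirling_Suc_Suc)
qed (simp add: signed_stirling_0)

lemma gbinomial_eq_sum_signed_stirling:
  fixes y :: "'a::field_char_0"
  shows "fact k * (y gchoose k) = (\<Sum>j\<le>k. of_int (signed_stirling k j) * y ^ j)"
proof (induction k)
  case 0
  then show ?case
    by (simp add: signed_stirling_0)
next
  case (Suc k)
  let ?s = "\<lambda>k j. of_int (signed_stirling k j) :: 'a"
  have "(\<Sum>j\<le>Suc k. ?s (Suc k) j * y ^ j) =
      y * (\<Sum>j\<le>k. ?s k j * y ^ j) - of_nat k * (\<Sum>j\<le>Suc k. ?s k j * y ^ j)"
    unfolding sum.atMost_Suc_shift
    by (simp add: signed_stirling_Suc_0 signed_stirling_Suc_Suc sum_distrib_left sum_subtractf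
                  algebra_simps del: sum.atMost_Suc)
  \<comment> \<open>The second sum runs one index past \<open>k\<close>, but s(k, k + 1) =
    0.\<close>
  also have "\<dots> = (y - of_nat k) * (fact k * (y gchoose k))"
    by (simp add: signed_stirling_eq_0 Suc left_diff_distrib)
  also have "\<dots> = fact (Suc k) * (y gchoose Suc k)"
    by (simp add: gbinomial_prod_rev del: of_nat_Suc)
  finally show ?case ..
qed

text \<open>
  Both sides are, up to constants, the coefficient of \<open>y\<^sup>j\<close> in the polynomial
  \<open>y gchoose k\<close>, the \<open>k\<close>-th coefficient of \<open>exp(y log(1 + z))\<close>.
\<close>

lemma fps_ln_1_power_nth:
  assumes "j \<le> k"
  shows "fps_ln (1::real) ^ j $ k = fact j * of_int (signed_stirling k j) / fact k"
proof -
  have "(\<Sum>j\<le>k. (fact k * (fps_ln (1::real) ^ j $ k) / fact j) * y ^ j) =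
      (\<Sum>j\<le>k. of_int (signed_stirling k j) * y ^ j)" for y
  proof -
    have "(\<Sum>j\<le>k. (fact k * (fps_ln (1::real) ^ j $ k) / fact j) * y ^ j) =
        fact k * ((fps_exp y oo fps_ln 1) $ k)"
      by (simp add: fps_compose_nth sum_distrib_left atMost_atLeast0 mult_ac)
    then show ?thesis
      by (simp add: fps_exp_compose_fps_ln_1 gbinomial_eq_sum_signed_stirling)
  qed
  then have "fact k * (fps_ln (1::real) ^ j $ k) / fact j = of_int (signed_stirling k j)"
    using assms polyfun_eq_coeffs[of "\<lambda>j. fact k * (fps_ln (1::real) ^ j $ k) / fact j" k
      "\<lambda>j. of_int (signed_stirling k j)"] by blast
  then show ?thesis
    by (simp add: field_simps)
qed

theorem proposition4p10:
  fixes x t :: real and k :: nat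
  assumes "t \<ge> 0" and "k \<ge> 1"
  shows "poisson_charlier k (x + t) t = (\<Sum>j=1..k. of_int (signed_stirling k j) * Q j x t)"
proof -
  \<comment> \<open>Substituting log(1 + z) undoes exp - 1, so the compound factor of
    \<open>egf_Q\<close> becomes exp(- t z).\<close>
  have ln: "(fps_exp 1 - 1) oo fps_ln 1 = (fps_X :: real fps)"
    by (simp add: fps_ln_fps_exp_inv fps_inv_fps_exp_compose)
  have "fps_exp (- t) * fps_binomial (x + t) = Abs_fps (\<lambda>j. Q j x t / fact j) oo fps_ln 1"
    by (simp add: egf_Q fps_compose_mult_distrib fps_exp_compose_fps_ln_1 ln mult.commute
             flip: fps_compose_assoc)
  then have "poisson_charlier k (x + t) t =
      (\<Sum>j=0..k. of_int (signed_stirling k j) * Q j x t)"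
    by (simp add: poisson_charlier_def fps_compose_nth fps_ln_1_power_nth sum_distrib_left mult.commute)
  \<comment> \<open>For \<open>k \<ge> 1\<close> the factor with \<open>i = 0\<close> is y itself,
    so the product vanishes at 0 and the sum may start at 1.\<close>
  moreover have "signed_stirling k 0 = 0"
    using \<open>k \<ge> 1\<close> by (auto simp: signed_stirling_def poly_prod simp flip: poly_0_coeff_0)
  ultimately show ?thesis
    by (simp add: sum.atLeast_Suc_atMost)
qed

end
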